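(* Let $p>0$ be a constant, and let $q:\mathbb{R}\to\mathbb{R}$ be a $2\pi$-periodic function with $q(x)\ge0$ and $\overline q>0$, such that for some $\omega_{\max}$ its Fourier coefficients satisfy $\hat q(\omega)=0$ for all integers $|\omega|>\omega_{\max}$. Then there exists a constant $C_q$, independent of $N$ and $\Delta t$, such that for every even positive integer $N$ and every $\Delta t>0$ the approximate solution operator $S_N(\Delta t)$ of the two-node block Krylov subspace spectral (KSS) method with prescribed nodes, applied to $u_{tt}=p\,u_{xx}-q(x)u$ on $(0,2\pi)$ with periodic boundary conditions, satisfies $$\|S_N(\Delta t)\|_{C_N}\le 1+C_q\|\tilde q\|_\infty\Delta t .$$
   Context: Coefficients. $\hat q(\omega)=\frac1{2\pi}\int_0^{2\pi}e^{-i\omega x}q(x)\,dx$. $\overline q$ is the average of $q$ over $[0,2\pi]$, $\overline p=p$; $\tilde q=q-\overline q$; $\|\cdot\|_\infty$ of a function is its sup norm. Grid. $N$ is even, $\Delta x=2\pi/N$, grid points $x_j=j\Delta x$, $j=0,\dots,N-1$; wave numbers $\omega\in\hat I_N=\{-N/2+1,\dots,N/2\}$. The discrete Fourier transform is the $N\times N$ matrix $F_N$ with entries $[F_N]_{\omega,j}=\frac1N e^{-i\omega x_j}$ (rows indexed by $\omega\in\hat I_N$). $D_N=F_N^{-1}\,\mathrm{diag}(i\omega)_{\omega\in\hat I_N}F_N$ is the Fourier first-derivative matrix. $Q_N$ is the diagonal matrix of values of $q$ at the grid points, and $L_N=-p\,D_N^2+Q_N$ is the discretization of $Lu=-p\,u_{xx}+q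 u$. KSS operator. Let $f_{11}(\lambda)=f_{22}(\lambda)=\cos(\lambda^{1/2}\Delta t)$, $f_{12}(\lambda)=\lambda^{-1/2}\sin(\lambda^{1/2}\Delta t)$, $f_{21}(\lambda)=-\lambda f_{12}(\lambda)$, with values at $\lambda=0$ defined by continuity. For $\omega\in\hat I_N$ the nodes are $l_{1,\omega}=0$ and $l_{2,\omega}=\overline p\,\omega^2+\overline q$, and $M_{ij,\omega}=\frac{f_{ij}(l_{2,\omega})-f_{ij}(l_{1,\omega})}{l_{2,\omega}-l_{1,\omega}}$. For $i,j\in\{1,2\}$, $S_{N,ij}(\Delta t)$ is the $N\times N$ matrix such that for every vector $\mathbf w\in\mathbb C^N$ and every $\omega\in\hat I_N$, $$[F_NS_{N,ij}(\Delta t)\mathbf w]_\omega=f_{ij}(l_{2,\omega})[F_N\mathbf w]_\omega+M_{ij,\omega}\,[F_N(L_N-l_{2,\omega}I)\mathbf w]_\omega .$$ $S_N(\Delta t)$ is the $2N\times2N$ block matrix with blocks $S_{N,ij}(\Delta t)$; one time step of the method maps $(\mathbf u^n,\mathbf u^n_t)$ to $S_N(\Delta t)(\mathbf u^n,\mathbf u_t^n)$. Norm. $C_N=F_N^{-1}\,\mathrm{diag}(\overline p\,\omega^2+\overline q)_{\omega\in\hat I_N}F_N$, the discretization of $C=-\overline p\,\partial_{xx}+\overline q I$. The $C_N$-norm is $\|(\mathbf u,\mathbf v)\|_{C_N}^2=\mathbf u^HC_N\mathbf u+\|\mathbf v\|_2^2$, and $\|S_N(\Delta t)\|_{C_N}$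 is the induced operator norm. *)

theory Defs
  imports "HOL-Analysis.Analysis" "Jordan_Normal_Form.Gauss_Jordan_Elimination"
    "Jordan_Normal_Form.Determinant"
begin

unbundle no vec_syntax

section \<open>Coefficients\<close>

definition average :: "(real \<Rightarrow> real) \<Rightarrow> real" where
  "average q = 1 / (2 * pi) * integral {0..2 * pi} q"

definition fourier_coeff :: "(real \<Rightarrow> real) \<Rightarrow> int \<Rightarrow> complex" where
  "fourier_coeff q \<omega> = 1 / (2 * of_real pi) *
     integral {0..2 * pi} (\<lambda>x. exp (- (\<i> * of_int \<omega> * of_real x)) * of_real (q x))"

text \<open>Extended-real valued, so that the supremum norm of an unbounded function is \<open>\<infinity>\<close>.\<close>
definition sup_norm :: "(real \<Rightarrow> real) \<Rightarrow> ereal" where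
  "sup_norm g = (SUP x. ereal \<bar>g x\<bar>)"

section \<open>Grid and Fourier matrices\<close>

definition grid_point :: "nat \<Rightarrow> nat \<Rightarrow> real" where
  "grid_point N j = real j * (2 * pi / real N)"

text \<open>The wave numbers \<open>-N/2+1, \<dots>, N/2\<close> are enumerated increasingly by the row
  indices \<open>0, \<dots>, N-1\<close>.\<close>
definition wave :: "nat \<Rightarrow> nat \<Rightarrow> int" where
  "wave N k = int k - int (N div 2) + 1"

definition dft_mat :: "nat \<Rightarrow> complex mat" where
  "dft_mat N = Matrix.mat N N
     (\<lambda>(k, j). 1 / of_nat N * exp (- (\<i> * of_int (wave N k) * of_real (grid_point N j))))"

definition dft_inv :: "nat \<Rightarrow> complex mat" where
  "dft_inv N = the (mat_inverse (dft_mat N))"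

definition deriv_mat :: "nat \<Rightarrow> complex mat" where
  "deriv_mat N = dft_inv N * mat_diag N (\<lambda>k. \<i> * of_int (wave N k)) * dft_mat N"

definition op_mat :: "real \<Rightarrow> (real \<Rightarrow> real) \<Rightarrow> nat \<Rightarrow> complex mat" where
  "op_mat p q N = (- of_real p) \<cdot>\<^sub>m (deriv_mat N ^\<^sub>m 2)
     + mat_diag N (\<lambda>j. of_real (q (grid_point N j)))"

section \<open>The two-node block KSS operator\<close>

definition f11 :: "real \<Rightarrow> real \<Rightarrow> real" where
  "f11 dt l = cos (sqrt l * dt)"

definition f12 :: "real \<Rightarrow> real \<Rightarrow> real" where
  "f12 dt l = (if l = 0 then dt else sin (sqrt l * dt) / sqrt l)"

definition f21 :: "real \<Rightarrow> real \<Rightarrow> real" where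
  "f21 dt l = - l * f12 dt l"

text \<open>The nonzero node, for the row with wave number \<open>wave N k\<close>; the constant \<open>p\<close> is its own
  average.\<close>
definition node :: "real \<Rightarrow> (real \<Rightarrow> real) \<Rightarrow> nat \<Rightarrow> nat \<Rightarrow> real" where
  "node p q N k = p * (of_int (wave N k))\<^sup>2 + average q"

text \<open>The \<open>M\<^sub>i\<^sub>j\<close>: divided difference over the nodes \<open>0\<close> and \<open>l\<close>.\<close>
definition div_diff :: "(real \<Rightarrow> real) \<Rightarrow> real \<Rightarrow> real" where
  "div_diff f l = (f l - f 0) / (l - 0)"

text \<open>The defining property of the block \<open>S\<^sub>N\<^sub>,\<^sub>i\<^sub>j\<close> belonging to \<open>f = f\<^sub>i\<^sub>j\<close>.\<close>
definition is_kss_block ::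
  "real \<Rightarrow> (real \<Rightarrow> real) \<Rightarrow> nat \<Rightarrow> (real \<Rightarrow> real) \<Rightarrow> complex mat \<Rightarrow> bool" where
  "is_kss_block p q N f S \<longleftrightarrow> S \<in> carrier_mat N N \<and>
     (\<forall>w \<in> carrier_vec N. \<forall>k < N.
        (dft_mat N *\<^sub>v (S *\<^sub>v w)) $ k =
          of_real (f (node p q N k)) * (dft_mat N *\<^sub>v w) $ k
          + of_real (div_diff f (node p q N k)) *
            (dft_mat N *\<^sub>v
              ((op_mat p q N - of_real (node p q N k) \<cdot>\<^sub>m 1\<^sub>m N) *\<^sub>v w)) $ k)"

definition kss_block :: "real \<Rightarrow> (real \<Rightarrow> real) \<Rightarrow> nat \<Rightarrow> (real \<Rightarrow> real) \<Rightarrow> complex mat" where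
  "kss_block p q N f = (THE S. is_kss_block p q N f S)"

definition kss_mat :: "real \<Rightarrow> (real \<Rightarrow> real) \<Rightarrow> nat \<Rightarrow> real \<Rightarrow> complex mat" where
  "kss_mat p q N dt = four_block_mat
     (kss_block p q N (f11 dt)) (kss_block p q N (f12 dt))
     (kss_block p q N (f21 dt)) (kss_block p q N (f11 dt))"

section \<open>The energy norm\<close>

definition energy_mat :: "real \<Rightarrow> (real \<Rightarrow> real) \<Rightarrow> nat \<Rightarrow> complex mat" where
  "energy_mat p q N = dft_inv N * mat_diag N (\<lambda>k. of_real (node p q N k)) * dft_mat N"

text \<open>The pair \<open>(u, v)\<close> is the concatenated vector \<open>u @\<^sub>v v\<close> of dimension \<open>2 N\<close>. Since
  \<open>x \<bullet>c y\<close> conjugates its second argument, \<open>(C *\<^sub>v u) \<bullet>c u\<close> is \<open>u\<^sup>H C u\<close>; it is real for the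
  Hermitian matrix used here.\<close>
definition energy_norm :: "real \<Rightarrow> (real \<Rightarrow> real) \<Rightarrow> nat \<Rightarrow> complex Matrix.vec \<Rightarrow> real" where
  "energy_norm p q N z =
     (let u = vec_first z N; v = vec_last z N
      in sqrt (Re ((energy_mat p q N *\<^sub>v u) \<bullet>c u) + (\<Sum>j<N. (cmod (v $ j))\<^sup>2)))"

definition energy_op_norm :: "real \<Rightarrow> (real \<Rightarrow> real) \<Rightarrow> nat \<Rightarrow> complex mat \<Rightarrow> ereal" where
  "energy_op_norm p q N A =
     (SUP z \<in> carrier_vec (2 * N) - {0\<^sub>v (2 * N)}.
        ereal (energy_norm p q N (A *\<^sub>v z) / energy_norm p q N z))"

section \<open>The definite descriptions above are well defined\<close>

lemma exp_root_of_unity_sum: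
  fixes m :: int
  assumes N: "N > 0" and m: "\<bar>m\<bar> < int N" "m \<noteq> 0"
  shows "(\<Sum>j<N. exp (\<i> * of_int m * of_real (grid_point N j))) = 0"
proof -
  define z where "z = exp (\<i> * of_real (2 * pi * of_int m / of_nat N))"
  have pow: "exp (\<i> * of_int m * of_real (grid_point N j)) = z ^ j" for j
    unfolding z_def grid_point_def exp_of_nat_mult[symmetric] by (simp add: algebra_simps)
  have "z ^ N = exp (\<i> * of_real (2 * pi * of_int m))"
    unfolding z_def exp_of_nat_mult[symmetric] using N by (simp add: algebra_simps)
  also have "\<dots> = 1"
    by (auto simp: exp_eq_1 intro!: exI[of _ m])
  finally have zN: "z ^ N = 1" .
  have "z \<noteq> 1"
  proof
    assume "z = 1"
    then obtain n :: int where "2 * pi * of_int m / of_nat N = of_int (2 * n) * pi"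
      unfolding z_def by (auto simp: exp_eq_1)
    hence "real_of_int m = real_of_int (n * int N)"
      using N by (simp add: field_simps)
    hence mn: "m = n * int N" by linarith
    with m have "n \<noteq> 0" by auto
    hence "1 * int N \<le> \<bar>n\<bar> * int N" by (intro mult_right_mono) auto
    hence "int N \<le> \<bar>m\<bar>" unfolding mn abs_mult by simp
    with m show False by simp
  qed
  thus ?thesis unfolding pow using zN geometric_sum[of z N] by simp
qed

lemma dft_inv:
  assumes N: "N > 0"
  shows "dft_inv N \<in> carrier_mat N N"
    and "dft_mat N * dft_inv N = 1\<^sub>m N" and "dft_inv N * dft_mat N = 1\<^sub>m N"
proof -
  define G where "G = Matrix.mat N N
    (\<lambda>(j, k). exp (\<i> * of_int (wave N k) * of_real (grid_point N j)))"
  have F: "dft_mat N \<in> carrier_mat N N" by (simp add: dft_mat_def)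
  have G: "G \<in> carrier_mat N N" by (simp add: G_def)
  have FG: "dft_mat N * G = 1\<^sub>m N"
  proof (rule eq_matI)
    fix k l assume kl: "k < dim_row (1\<^sub>m N :: complex mat)" "l < dim_col (1\<^sub>m N :: complex mat)"
    have "(dft_mat N * G) $$ (k, l) =
      (\<Sum>j<N. 1 / of_nat N * exp (- (\<i> * of_int (wave N k) * of_real (grid_point N j)))
        * exp (\<i> * of_int (wave N l) * of_real (grid_point N j)))"
      using kl by (simp add: dft_mat_def G_def scalar_prod_def lessThan_atLeast0)
    also have "\<dots> = 1 / of_nat N *
      (\<Sum>j<N. exp (\<i> * of_int (int l - int k) * of_real (grid_point N j)))"
      unfolding sum_distrib_left
      by (rule sum.cong) (auto simp: wave_def algebra_simps simp flip: exp_add)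
    also have "\<dots> = (if k = l then 1 else 0)"
      using exp_root_of_unity_sum[OF N, of "int l - int k"] kl N by auto
    finally show "(dft_mat N * G) $$ (k, l) = 1\<^sub>m N $$ (k, l)" using kl by simp
  qed (auto simp: dft_mat_def G_def)
  have GF: "G * dft_mat N = 1\<^sub>m N"
    by (rule mat_mult_left_right_inverse[OF F G FG])
  have "dft_mat N \<in> Units (ring_mat TYPE(complex) N ())"
    unfolding Units_def ring_mat_def using F G FG GF by auto
  then obtain B where B: "mat_inverse (dft_mat N) = Some B"
    using mat_inverse(1)[OF F, where b = "()"] by (cases "mat_inverse (dft_mat N)") auto
  show "dft_inv N \<in> carrier_mat N N"
    "dft_mat N * dft_inv N = 1\<^sub>m N" "dft_inv N * dft_mat N = 1\<^sub>m N"
    using mat_inverse(2)[OF F B] by (auto simp: dft_inv_def B)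
qed

lemma ex1_kss_block:
  assumes N: "N > 0"
  shows "\<exists>!S. is_kss_block p q N f S"
proof -
  let ?F = "dft_mat N" and ?G = "dft_inv N"
  let ?A = "\<lambda>k. op_mat p q N - of_real (node p q N k) \<cdot>\<^sub>m 1\<^sub>m N"
  note inv = dft_inv[OF N]
  have F: "?F \<in> carrier_mat N N" by (simp add: dft_mat_def)
  have L: "op_mat p q N \<in> carrier_mat N N" by (simp add: op_mat_def)
  have A: "?A k \<in> carrier_mat N N" for k
    by (intro minus_carrier_mat smult_carrier_mat one_carrier_mat)
  define R where "R = Matrix.mat N N (\<lambda>(k, j). of_real (f (node p q N k)) * ?F $$ (k, j)
    + of_real (div_diff f (node p q N k)) * (?F * ?A k) $$ (k, j))"
  have R: "R \<in> carrier_mat N N" by (simp add: R_def)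
  have Rw: "(R *\<^sub>v w) $ k = of_real (f (node p q N k)) * (?F *\<^sub>v w) $ k
      + of_real (div_diff f (node p q N k)) * (?F *\<^sub>v (?A k *\<^sub>v w)) $ k"
    if w: "w \<in> carrier_vec N" and k: "k < N" for w k
  proof -
    have "(?F *\<^sub>v (?A k *\<^sub>v w)) = (?F * ?A k) *\<^sub>v w"
      by (rule assoc_mult_mat_vec[symmetric, OF F A w])
    moreover have "(B *\<^sub>v w) $ k = (\<Sum>j<N. B $$ (k, j) * w $ j)"
      if "B \<in> carrier_mat N N" for B :: "complex mat"
      using that w k by (simp add: scalar_prod_def lessThan_atLeast0)
    moreover have "?F * ?A k \<in> carrier_mat N N" by (rule mult_carrier_mat[OF F A])
    ultimately show ?thesis using F R k
      by (simp only:)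
        (simp add: R_def sum_distrib_left sum.distrib distrib_right mult.assoc)
  qed
  have char: "is_kss_block p q N f S \<longleftrightarrow> S \<in> carrier_mat N N \<and> ?F * S = R" for S
  proof (cases "S \<in> carrier_mat N N")
    case S: True
    have FS: "?F * S \<in> carrier_mat N N" by (rule mult_carrier_mat[OF F S])
    have "is_kss_block p q N f S \<longleftrightarrow>
      (\<forall>w \<in> carrier_vec N. \<forall>k < N. (?F *\<^sub>v (S *\<^sub>v w)) $ k = (R *\<^sub>v w) $ k)"
      using S Rw by (simp add: is_kss_block_def)
    also have "\<dots> \<longleftrightarrow> (\<forall>w \<in> carrier_vec N. (?F * S) *\<^sub>v w = R *\<^sub>v w)"
    proof (rule ball_cong[OF refl])
      fix w :: "complex Matrix.vec" assume w: "w \<in> carrier_vec N"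
      have e: "?F *\<^sub>v (S *\<^sub>v w) = (?F * S) *\<^sub>v w"
        by (rule assoc_mult_mat_vec[symmetric, OF F S w])
      show "(\<forall>k < N. (?F *\<^sub>v (S *\<^sub>v w)) $ k = (R *\<^sub>v w) $ k) \<longleftrightarrow> (?F * S) *\<^sub>v w = R *\<^sub>v w"
        unfolding e using FS R
        by (metis carrier_matD(1) dim_mult_mat_vec eq_vecI)
    qed
    also have "\<dots> \<longleftrightarrow> ?F * S = R"
    proof
      assume *: "\<forall>w \<in> carrier_vec N. (?F * S) *\<^sub>v w = R *\<^sub>v w"
      show "?F * S = R"
      proof (rule mat_col_eqI)
        fix j assume "j < dim_col R"
        hence j: "j < N" using R by simp
        have "col (?F * S) j = (?F * S) *\<^sub>v unit_vec N j" "col R j = R *\<^sub>v unit_vec N j"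
          using FS R j by (auto intro!: eq_vecI)
        thus "col (?F * S) j = col R j" using * by simp
      qed (use FS R in auto)
    qed auto
    finally show ?thesis using S by simp
  qed (simp add: is_kss_block_def)
  show ?thesis
  proof (rule ex1I[of _ "?G * R"])
    have "?F * (?G * R) = R"
      using assoc_mult_mat[OF F inv(1) R] inv(2) R by simp
    thus "is_kss_block p q N f (?G * R)" unfolding char using mult_carrier_mat[OF inv(1) R] by simp
  next
    fix S assume "is_kss_block p q N f S"
    hence S: "S \<in> carrier_mat N N" and "?F * S = R" unfolding char by auto
    thus "S = ?G * R"
      using assoc_mult_mat[OF inv(1) F S] inv(3) by simp
  qed
qed

end

theory Submission
  imports Defs
begin

text \<open>In Fourier variables, let \<open>l = p \<omega>\<^sup>2 + average q\<close> and \<open>s = \<surd>l\<close>. The energy norm is \<open>\<surd>N\<close> times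
  the Euclidean norm of the family of pairs \<open>(s (F u)\<^sub>\<omega>, (F v)\<^sub>\<omega>)\<close>. Since row \<open>\<omega>\<close> of
  \<open>F (L - l I)\<close> is row \<open>\<omega>\<close> of \<open>F (Q - average q I)\<close>, one step rotates each pair by the
  angle \<open>s dt\<close> and adds a perturbation by the Fourier coefficients of \<open>(q - average q) u\<close> and
  \<open>(q - average q) v\<close>, whose factors are divided differences of size \<open>O(dt)\<close> because
  \<open>\<bar>cos t - 1\<bar>\<close> and \<open>\<bar>sin t\<bar>\<close> are at most \<open>\<bar>t\<bar>\<close>. The bound is uniform in \<open>N\<close> since
  \<open>s\<close> is bounded below by the square root of the average.\<close>

section \<open>Matrix-vector products with scalar multiples and diagonal matrices\<close>

lemma smult_mat_mult_vec:
  assumes "A \<in> carrier_mat nr nc" "w \<in> carrier_vec nc"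
  shows "(c \<cdot>\<^sub>m A) *\<^sub>v w = c \<cdot>\<^sub>v (A *\<^sub>v w)"
  using assms by (intro eq_vecI) (auto simp: scalar_prod_def sum_distrib_left mult.assoc)

lemma mult_mat_diag_vec_index:
  assumes "w \<in> carrier_vec N" "k < N"
  shows "(mat_diag N f *\<^sub>v w) $ k = f k * w $ k"
proof -
  have "(mat_diag N f *\<^sub>v w) $ k = (\<Sum>j<N. (if k = j then f j else 0) * w $ j)"
    using assms by (simp add: mat_diag_def scalar_prod_def lessThan_atLeast0)
  also have "\<dots> = (\<Sum>j<N. if k = j then f j * w $ j else 0)"
    by (rule sum.cong) auto
  finally show ?thesis using assms by simp
qed

section \<open>Orthogonality and Parseval's identity for the discrete Fourier transform\<close>

lemma dft_mat_carrier [simp]: "dft_mat N \<in> carrier_mat N N"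
  by (simp add: dft_mat_def)

lemma dim_dft_mat [simp]: "dim_row (dft_mat N) = N" "dim_col (dft_mat N) = N"
  by (simp_all add: dft_mat_def)

text \<open>Up to a constant phase, the summands are powers of one root of unity, so the sum over
  wave numbers becomes a sum over grid points that \<open>exp_root_of_unity_sum\<close>
  evaluates.\<close>

lemma dft_column_orthogonality:
  assumes j: "j < N" and m: "m < N"
  shows "(\<Sum>k<N. dft_mat N $$ (k, j) * cnj (dft_mat N $$ (k, m))) =
    (if j = m then 1 / of_nat N else 0)"
proof -
  from j have N: "N > 0" by simp
  define c :: complex where
    "c = exp (- (\<i> * of_int (wave N 0) * of_real (grid_point N j - grid_point N m)))"
  have "(\<Sum>k<N. dft_mat N $$ (k, j) * cnj (dft_mat N $$ (k, m))) =
    (\<Sum>k<N. c / of_nat N ^ 2 * exp (\<i> * of_int (int m - int j) * of_real (grid_point N k)))"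
  proof (rule sum.cong[OF refl])
    fix k assume "k \<in> {..<N}"
    hence "dft_mat N $$ (k, j) * cnj (dft_mat N $$ (k, m)) = 1 / of_nat N ^ 2 *
      exp (- (\<i> * of_int (wave N k) * of_real (grid_point N j))
        + \<i> * of_int (wave N k) * of_real (grid_point N m))"
      using j m by (simp add: dft_mat_def exp_cnj mult_exp_exp power2_eq_square)
    \<comment> \<open>The roles of index and grid point are exchanged by
      \<open>k * grid_point N j = j * grid_point N k\<close>; the offset \<open>wave N 0\<close>
      contributes the phase \<open>c\<close>, which is free of \<open>k\<close>.\<close>
    also have "- (\<i> * of_int (wave N k) * of_real (grid_point N j))
        + \<i> * of_int (wave N k) * of_real (grid_point N m) =
      - (\<i> * of_int (wave N 0) * of_real (grid_point N j - grid_point N m))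
        + \<i> * of_int (int m - int j) * of_real (grid_point N k)"
      using N by (simp add: wave_def grid_point_def field_simps)
    finally show "dft_mat N $$ (k, j) * cnj (dft_mat N $$ (k, m)) =
      c / of_nat N ^ 2 * exp (\<i> * of_int (int m - int j) * of_real (grid_point N k))"
      unfolding c_def exp_add by simp
  qed
  also have "\<dots> = c / of_nat N ^ 2 *
    (\<Sum>k<N. exp (\<i> * of_int (int m - int j) * of_real (grid_point N k)))"
    by (simp add: sum_distrib_left)
  also have "\<dots> = (if j = m then 1 / of_nat N else 0)"
  proof (cases "j = m")
    case True
    thus ?thesis using N by (simp add: c_def power2_eq_square)
  next
    case False
    hence "(\<Sum>k<N. exp (\<i> * of_int (int m - int j) * of_real (grid_point N k))) = 0"
      using j m by (intro exp_root_of_unity_sum[OF N]) auto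
    thus ?thesis using False by simp
  qed
  finally show ?thesis .
qed

text \<open>Column orthogonality makes \<open>dft_mat N\<close> unitary up to scaling by
  \<open>sqrt N\<close>; the factor \<open>N\<close> comes from the normalisation
  \<open>1 / N\<close> of its entries.\<close>

lemma dft_parseval:
  assumes x: "x \<in> carrier_vec N" and y: "y \<in> carrier_vec N"
  shows "x \<bullet>c y = of_nat N * (\<Sum>k<N. (dft_mat N *\<^sub>v x) $ k * cnj ((dft_mat N *\<^sub>v y) $ k))"
proof -
  let ?F = "\<lambda>k j. dft_mat N $$ (k, j)"
  have F: "(dft_mat N *\<^sub>v w) $ k = (\<Sum>j<N. ?F k j * w $ j)"
    if "w \<in> carrier_vec N" "k < N" for w k
    using that by (simp add: dft_mat_def scalar_prod_def lessThan_atLeast0)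
  have "(\<Sum>k<N. (dft_mat N *\<^sub>v x) $ k * cnj ((dft_mat N *\<^sub>v y) $ k)) =
    (\<Sum>k<N. \<Sum>j<N. \<Sum>m<N. (x $ j * cnj (y $ m)) * (?F k j * cnj (?F k m)))"
    using x y by (intro sum.cong[OF refl]) (simp add: F cnj_sum sum_product mult_ac del: index_mult_mat_vec)
  also have "\<dots> = (\<Sum>j<N. \<Sum>m<N. (x $ j * cnj (y $ m)) * (\<Sum>k<N. ?F k j * cnj (?F k m)))"
    unfolding sum_distrib_left
    by (subst sum.swap, rule sum.cong[OF refl], rule sum.swap)
  also have "\<dots> = (\<Sum>j<N. \<Sum>m<N. if j = m then x $ j * cnj (y $ m) / of_nat N else 0)"
    by (intro sum.cong[OF refl]) (simp add: dft_column_orthogonality)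
  also have "\<dots> = (\<Sum>j<N. x $ j * cnj (y $ j)) / of_nat N"
    by (simp add: sum_divide_distrib)
  finally show ?thesis using x y
    by (cases "N = 0") (auto simp: scalar_prod_def lessThan_atLeast0)
qed

lemma dft_parseval_norm:
  assumes "w \<in> carrier_vec N"
  shows "L2_set (\<lambda>j. cmod (w $ j)) {..<N} =
    sqrt (real N) * L2_set (\<lambda>k. cmod ((dft_mat N *\<^sub>v w) $ k)) {..<N}"
proof -
  have "(of_real (\<Sum>j<N. (cmod (w $ j))\<^sup>2) :: complex) = w \<bullet>c w"
    unfolding of_real_sum complex_norm_square
    using assms by (simp add: scalar_prod_def lessThan_atLeast0)
  also have "\<dots> = of_real (real N * (\<Sum>k<N. (cmod ((dft_mat N *\<^sub>v w) $ k))\<^sup>2))"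
    unfolding dft_parseval[OF assms assms] of_real_mult of_real_sum complex_norm_square by simp
  finally have "(\<Sum>j<N. (cmod (w $ j))\<^sup>2) = real N * (\<Sum>k<N. (cmod ((dft_mat N *\<^sub>v w) $ k))\<^sup>2)"
    unfolding of_real_eq_iff .
  thus ?thesis by (simp add: L2_set_def real_sqrt_mult)
qed

section \<open>Fourier multipliers, the KSS blocks and the potential\<close>

text \<open>The DFT cancels the leading \<open>dft_inv N\<close>. Both \<open>deriv_mat\<close> and
  \<open>energy_mat\<close> have this conjugated form.\<close>

lemma dft_multiplier_index:
  assumes w: "w \<in> carrier_vec N" and k: "k < N"
  shows "(dft_mat N *\<^sub>v ((dft_inv N * mat_diag N f * dft_mat N) *\<^sub>v w)) $ k =
    f k * (dft_mat N *\<^sub>v w) $ k"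
proof -
  from k have N: "N > 0" by simp
  note G = dft_inv[OF N]
  let ?D = "mat_diag N f" and ?F = "dft_mat N" and ?G = "dft_inv N"
  have D: "?D \<in> carrier_mat N N" by simp
  have Fw: "?F *\<^sub>v w \<in> carrier_vec N" by (rule mult_mat_vec_carrier[OF dft_mat_carrier w])
  have "?F * (?G * ?D * ?F) = (?F * ?G) * (?D * ?F)"
    unfolding assoc_mult_mat[OF G(1) D dft_mat_carrier]
    by (rule assoc_mult_mat[symmetric, OF dft_mat_carrier G(1) mult_carrier_mat[OF D dft_mat_carrier]])
  also have "\<dots> = ?D * ?F" unfolding G(2)
    by (rule left_mult_one_mat[OF mult_carrier_mat[OF D dft_mat_carrier]])
  finally have e: "?F * (?G * ?D * ?F) = ?D * ?F" .
  have "?F *\<^sub>v ((?G * ?D * ?F) *\<^sub>v w) = (?F * (?G * ?D * ?F)) *\<^sub>v w"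
    by (rule assoc_mult_mat_vec[symmetric, OF dft_mat_carrier _ w])
      (intro mult_carrier_mat[OF mult_carrier_mat[OF G(1) D] dft_mat_carrier])
  also have "\<dots> = ?D *\<^sub>v (?F *\<^sub>v w)"
    unfolding e by (rule assoc_mult_mat_vec[OF D dft_mat_carrier w])
  finally show ?thesis using mult_mat_diag_vec_index[OF Fw k] by simp
qed

text \<open>In row \<open>k\<close> the second derivative acts as multiplication by minus the
  squared wave number, so its contribution cancels the part of the node beyond
  \<open>average q\<close>. Only the fluctuation of the potential survives. The cancellation is
  specific to row \<open>k\<close>, since the node depends on \<open>k\<close>.\<close>

lemma dft_op_mat_minus_node_index:
  assumes w: "w \<in> carrier_vec N" and k: "k < N"
  shows "(dft_mat N *\<^sub>v ((op_mat p q N - of_real (node p q N k) \<cdot>\<^sub>m 1\<^sub>m N) *\<^sub>v w)) $ k =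
    (dft_mat N *\<^sub>v (mat_diag N (\<lambda>j. of_real (q (grid_point N j) - average q)) *\<^sub>v w)) $ k"
proof -
  from k have N: "N > 0" by simp
  let ?F = "dft_mat N" and ?D = "deriv_mat N"
  let ?Q = "mat_diag N (\<lambda>j. of_real (q (grid_point N j)))" and ?l = "node p q N k"
  let ?R = "mat_diag N (\<lambda>j. of_real (q (grid_point N j) - average q)) :: complex mat"
  have D: "?D \<in> carrier_mat N N"
    unfolding deriv_mat_def
    by (intro mult_carrier_mat[OF mult_carrier_mat[OF dft_inv(1)[OF N]] dft_mat_carrier]) simp
  have Q: "?Q \<in> carrier_mat N N" by simp
  have R: "?R \<in> carrier_mat N N" by simp
  have Dw: "?D *\<^sub>v w \<in> carrier_vec N" by (rule mult_mat_vec_carrier[OF D w])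
  have DDw: "?D *\<^sub>v (?D *\<^sub>v w) \<in> carrier_vec N" by (rule mult_mat_vec_carrier[OF D Dw])
  have Qw: "?Q *\<^sub>v w \<in> carrier_vec N" by (rule mult_mat_vec_carrier[OF Q w])
  have Rw: "?R *\<^sub>v w \<in> carrier_vec N" by (rule mult_mat_vec_carrier[OF R w])
  have DD: "?D ^\<^sub>m 2 = ?D * ?D" using D by (simp add: numeral_2_eq_2)
  have one: "of_real ?l \<cdot>\<^sub>m 1\<^sub>m N \<in> carrier_mat N N" by simp
  have pDD: "(- of_real p) \<cdot>\<^sub>m (?D * ?D) \<in> carrier_mat N N"
    by (intro smult_carrier_mat mult_carrier_mat[OF D D])
  have "(op_mat p q N - of_real ?l \<cdot>\<^sub>m 1\<^sub>m N) *\<^sub>v w =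
    ((- of_real p) \<cdot>\<^sub>v (?D *\<^sub>v (?D *\<^sub>v w)) + ?Q *\<^sub>v w) - of_real ?l \<cdot>\<^sub>v w"
    unfolding op_mat_def DD
    using minus_mult_distrib_mat_vec[OF add_carrier_mat[OF Q] one w]
      add_mult_distrib_mat_vec[OF pDD Q w]
      smult_mat_mult_vec[OF mult_carrier_mat[OF D D] w]
      smult_mat_mult_vec[OF one_carrier_mat w]
      assoc_mult_mat_vec[OF D D w] w
    by simp
  \<comment> \<open>The \<open>average q\<close> in the node is moved into the potential; the
    remainder \<open>?l - average q\<close> is kept apart, to cancel against the derivative term
    after the DFT.\<close>
  also have "\<dots> = (- of_real p) \<cdot>\<^sub>v (?D *\<^sub>v (?D *\<^sub>v w)) + (?R *\<^sub>v w - of_real (?l - average q) \<cdot>\<^sub>v w)"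
  proof (rule eq_vecI)
    fix i assume "i < dim_vec ((- of_real p) \<cdot>\<^sub>v (?D *\<^sub>v (?D *\<^sub>v w)) +
      (?R *\<^sub>v w - of_real (?l - average q) \<cdot>\<^sub>v w))"
    hence i: "i < N" using w by simp
    show "((- of_real p) \<cdot>\<^sub>v (?D *\<^sub>v (?D *\<^sub>v w)) + ?Q *\<^sub>v w - of_real ?l \<cdot>\<^sub>v w) $ i =
      ((- of_real p) \<cdot>\<^sub>v (?D *\<^sub>v (?D *\<^sub>v w)) + (?R *\<^sub>v w - of_real (?l - average q) \<cdot>\<^sub>v w)) $ i"
      using i w DDw Qw Rw mult_mat_diag_vec_index[OF w i]
      by (simp del: index_mult_mat_vec add: algebra_simps carrier_matD[OF Q] carrier_matD[OF R])
  qed (use w DDw Rw Qw in auto)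
  finally have e: "(op_mat p q N - of_real ?l \<cdot>\<^sub>m 1\<^sub>m N) *\<^sub>v w =
    (- of_real p) \<cdot>\<^sub>v (?D *\<^sub>v (?D *\<^sub>v w)) + (?R *\<^sub>v w - of_real (?l - average q) \<cdot>\<^sub>v w)" .
  have Fx: "?F *\<^sub>v x \<in> carrier_vec N" if "x \<in> carrier_vec N" for x
    by (rule mult_mat_vec_carrier[OF dft_mat_carrier that])
  have "?F *\<^sub>v ((op_mat p q N - of_real ?l \<cdot>\<^sub>m 1\<^sub>m N) *\<^sub>v w) =
    (- of_real p) \<cdot>\<^sub>v (?F *\<^sub>v (?D *\<^sub>v (?D *\<^sub>v w)))
      + (?F *\<^sub>v (?R *\<^sub>v w) - of_real (?l - average q) \<cdot>\<^sub>v (?F *\<^sub>v w))"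
    unfolding e using w DDw Rw
    by (simp add: mult_add_distrib_mat_vec[OF dft_mat_carrier]
        mult_minus_distrib_mat_vec[OF dft_mat_carrier] mult_mat_vec[OF dft_mat_carrier])
  moreover have "(?F *\<^sub>v (?D *\<^sub>v (?D *\<^sub>v w))) $ k =
    (\<i> * of_int (wave N k))\<^sup>2 * (?F *\<^sub>v w) $ k"
    using dft_multiplier_index[OF Dw k] dft_multiplier_index[OF w k]
    by (simp add: deriv_mat_def power2_eq_square del: index_mult_mat_vec)
  ultimately show ?thesis
    using Fx[OF w] Fx[OF DDw] Fx[OF Rw] k
    by (simp add: node_def power_mult_distrib algebra_simps del: index_mult_mat_vec)
qed

text \<open>Unique existence turns the definite description into its defining property, in which the
  residual of the node is then replaced by the potential's fluctuation.\<close>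

lemma kss_block:
  assumes "N > 0"
  shows "kss_block p q N f \<in> carrier_mat N N"
    and "w \<in> carrier_vec N \<Longrightarrow> k < N \<Longrightarrow> (dft_mat N *\<^sub>v (kss_block p q N f *\<^sub>v w)) $ k =
      of_real (f (node p q N k)) * (dft_mat N *\<^sub>v w) $ k + of_real (div_diff f (node p q N k)) *
        (dft_mat N *\<^sub>v (mat_diag N (\<lambda>j. of_real (q (grid_point N j) - average q)) *\<^sub>v w)) $ k"
proof -
  have "is_kss_block p q N f (kss_block p q N f)"
    unfolding kss_block_def by (rule theI'[OF ex1_kss_block[OF assms]])
  thus "kss_block p q N f \<in> carrier_mat N N"
    and "w \<in> carrier_vec N \<Longrightarrow> k < N \<Longrightarrow> (dft_mat N *\<^sub>v (kss_block p q N f *\<^sub>v w)) $ k =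
      of_real (f (node p q N k)) * (dft_mat N *\<^sub>v w) $ k + of_real (div_diff f (node p q N k)) *
        (dft_mat N *\<^sub>v (mat_diag N (\<lambda>j. of_real (q (grid_point N j) - average q)) *\<^sub>v w)) $ k"
    unfolding is_kss_block_def by (simp_all add: dft_op_mat_minus_node_index del: index_mult_mat_vec)
qed

text \<open>Multiplication by \<open>g\<close> is pointwise on the grid, where the bound is
  immediate. Parseval carries it to Fourier coefficients; its factors \<open>sqrt N\<close> cancel,
  so no dependence on \<open>N\<close> enters.\<close>

lemma dft_potential_bound:
  assumes w: "w \<in> carrier_vec N" and B: "\<And>j. j < N \<Longrightarrow> \<bar>g j\<bar> \<le> B"
  shows "L2_set (\<lambda>k. cmod ((dft_mat N *\<^sub>v (mat_diag N (\<lambda>j. of_real (g j)) *\<^sub>v w)) $ k)) {..<N}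
    \<le> B * L2_set (\<lambda>k. cmod ((dft_mat N *\<^sub>v w) $ k)) {..<N}"
proof (cases "N = 0")
  case False
  hence "0 \<le> B" using B[of 0] by simp
  have gw: "mat_diag N (\<lambda>j. of_real (g j)) *\<^sub>v w \<in> carrier_vec N"
    by (rule mult_mat_vec_carrier[OF _ w]) simp
  have "L2_set (\<lambda>j. cmod ((mat_diag N (\<lambda>j. of_real (g j)) *\<^sub>v w) $ j)) {..<N}
    \<le> L2_set (\<lambda>j. B * cmod (w $ j)) {..<N}"
    using B by (intro L2_set_mono)
      (auto simp: mult_mat_diag_vec_index[OF w] norm_mult intro!: mult_right_mono
        simp del: index_mult_mat_vec)
  also have "\<dots> = B * L2_set (\<lambda>j. cmod (w $ j)) {..<N}"
    using \<open>0 \<le> B\<close> by (simp add: L2_set_right_distrib)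
  finally show ?thesis
    using False unfolding dft_parseval_norm[OF gw] dft_parseval_norm[OF w] by simp
qed simp

section \<open>The energy norm in Fourier variables\<close>

text \<open>\<open>energy_mat\<close> is the Fourier multiplier with symbol \<open>node\<close>, so
  Parseval diagonalises the quadratic form. The weight \<open>sqrt (node p q N k)\<close> allows
  each mode to be measured by the Euclidean norm of a pair.\<close>

lemma energy_norm_dft:
  assumes u: "u \<in> carrier_vec N" and v: "v \<in> carrier_vec N"
    and node: "\<And>k. k < N \<Longrightarrow> node p q N k \<ge> 0"
  shows "energy_norm p q N (u @\<^sub>v v) = sqrt (real N) *
    L2_set (\<lambda>k. norm (of_real (sqrt (node p q N k)) * (dft_mat N *\<^sub>v u) $ k,
      (dft_mat N *\<^sub>v v) $ k)) {..<N}"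
proof (cases "N = 0")
  case True
  thus ?thesis using u v by (simp add: energy_norm_def scalar_prod_def)
next
  case False
  let ?F = "dft_mat N" and ?C = "energy_mat p q N"
  have C: "?C \<in> carrier_mat N N"
    unfolding energy_mat_def using False
    by (intro mult_carrier_mat[OF mult_carrier_mat[OF dft_inv(1)] dft_mat_carrier]) auto
  have Cu: "?C *\<^sub>v u \<in> carrier_vec N" by (rule mult_mat_vec_carrier[OF C u])
  have first: "vec_first (u @\<^sub>v v) N = u" and last: "vec_last (u @\<^sub>v v) N = v"
    using u v by (auto simp: vec_first_def vec_last_def intro!: eq_vecI)
  have "(?C *\<^sub>v u) \<bullet>c u =
    of_nat N * (\<Sum>k<N. of_real (node p q N k) * (?F *\<^sub>v u) $ k * cnj ((?F *\<^sub>v u) $ k))"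
    unfolding dft_parseval[OF Cu u]
    by (simp add: energy_mat_def dft_multiplier_index[OF u] del: index_mult_mat_vec)
  \<comment> \<open>The quadratic form is real, so the \<open>Re\<close> in
    \<open>energy_norm\<close> loses nothing.\<close>
  also have "\<dots> = of_real (real N * (\<Sum>k<N. node p q N k * (cmod ((?F *\<^sub>v u) $ k))\<^sup>2))"
    unfolding of_real_mult of_real_sum complex_norm_square by (simp add: mult.assoc)
  finally have "Re ((?C *\<^sub>v u) \<bullet>c u) = real N * (\<Sum>k<N. node p q N k * (cmod ((?F *\<^sub>v u) $ k))\<^sup>2)"
    by (metis Re_complex_of_real)
  moreover have "(\<Sum>j<N. (cmod (v $ j))\<^sup>2) = real N * (\<Sum>k<N. (cmod ((?F *\<^sub>v v) $ k))\<^sup>2)"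
    using arg_cong[OF dft_parseval_norm[OF v], of "\<lambda>x. x\<^sup>2"]
    by (simp add: L2_set_def power_mult_distrib sum_nonneg del: index_mult_mat_vec)
  ultimately show ?thesis
    unfolding energy_norm_def Let_def first last using node
    by (simp add: L2_set_def norm_Pair norm_mult power_mult_distrib real_sqrt_mult
        distrib_left[symmetric] sum.distrib[symmetric] del: index_mult_mat_vec)
qed

lemma energy_norm_nonneg:
  assumes "z \<in> carrier_vec (2 * N)" and "\<And>k. k < N \<Longrightarrow> node p q N k \<ge> 0"
  shows "energy_norm p q N z \<ge> 0"
proof -
  have "z = vec_first z N @\<^sub>v vec_last z N" using assms(1) by (simp add: mult_2)
  moreover have "energy_norm p q N (vec_first z N @\<^sub>v vec_last z N) \<ge> 0"
    by (subst energy_norm_dft[OF _ _ assms(2)]) auto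
  ultimately show ?thesis by simp
qed

section \<open>The perturbed rotation in a single Fourier mode\<close>

text \<open>Half-angle formula with \<open>sin\<^sup>2 \<le> \<bar>sin\<bar>\<close>. A bound linear
  in \<open>x = s * dt\<close> is wanted: divided by \<open>s\<close> it leaves \<open>dt\<close>,
  whereas the quadratic bound would leave a factor growing with the wave number.\<close>

lemma abs_cos_minus_one_le: "\<bar>cos x - 1\<bar> \<le> \<bar>x\<bar>" for x :: real
proof -
  have "cos x - 1 = - 2 * (sin (x / 2))\<^sup>2"
    using cos_double_sin[of "x / 2"] by simp
  moreover have "(sin (x / 2))\<^sup>2 \<le> \<bar>sin (x / 2)\<bar>"
    using abs_sin_le_one[of "x / 2"] by (metis abs_ge_zero mult_left_le power2_abs power2_eq_square)
  ultimately show ?thesis using abs_sin_x_le_abs_x[of "x / 2"] by simp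
qed

text \<open>A real orthogonal matrix rotates the real and imaginary parts separately. This is energy
  conservation for the problem with \<open>q\<close> replaced by its average.\<close>

lemma norm_rotation:
  fixes x y :: complex
  shows "norm (of_real (cos t) * x + of_real (sin t) * y,
    - of_real (sin t) * x + of_real (cos t) * y) = norm (x, y)"
proof -
  have c: "(cos t)\<^sup>2 = 1 - (sin t)\<^sup>2" by (simp add: cos_squared_eq)
  show ?thesis
    unfolding norm_Pair cmod_power2
    by (rule arg_cong[where f = sqrt]) (simp add: power2_sum power2_diff algebra_simps c)
qed

text \<open>Here \<open>x\<close>, \<open>y\<close> stand for the Fourier coefficients of
  \<open>u\<close>, \<open>v\<close> in one mode, and \<open>a\<close>, \<open>b\<close> for those
  of their products with the fluctuation of \<open>q\<close>. The terms in \<open>x\<close>,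
  \<open>y\<close> form a rotation; those in \<open>a\<close>, \<open>b\<close> are an error of size
  \<open>dt\<close>, uniform over all \<open>s \<ge> c\<close>.\<close>

lemma kss_mode_bound:
  fixes x y a b :: complex
  assumes s: "s \<ge> c" and c: "c > 0" and dt: "dt > 0"
  defines "l \<equiv> s\<^sup>2"
  shows "norm (of_real s *
        (of_real (f11 dt l) * x + of_real (div_diff (f11 dt) l) * a
          + (of_real (f12 dt l) * y + of_real (div_diff (f12 dt) l) * b)),
      of_real (f21 dt l) * x + of_real (div_diff (f21 dt) l) * a
        + (of_real (f11 dt l) * y + of_real (div_diff (f11 dt) l) * b))
    \<le> norm (of_real s * x, y) + dt * (2 * cmod a + 3 / c * cmod b)"
    (is "norm ?z \<le> _")
proof -
  have s0: "s > 0" using s c by simp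
  have sl: "sqrt l = s" "l \<noteq> 0" using s0 by (auto simp: l_def)
  define e1 where "e1 = of_real (s * div_diff (f11 dt) l) * a + of_real (s * div_diff (f12 dt) l) * b"
  define e2 where "e2 = of_real (div_diff (f21 dt) l) * a + of_real (div_diff (f11 dt) l) * b"
  define t where "t = s * dt"
  \<comment> \<open>The weight \<open>s\<close> produces the rotation:
    \<open>s * f12 dt l = sin t\<close> and \<open>f21 dt l = - sin t * s\<close>.\<close>
  have "?z = (of_real (cos t) * (of_real s * x) + of_real (sin t) * y,
      - of_real (sin t) * (of_real s * x) + of_real (cos t) * y) + (e1, e2)"
    using s0 sl
    by (simp add: e1_def e2_def t_def f11_def f12_def f21_def l_def power2_eq_square field_simps)
  hence "norm ?z \<le> norm (of_real s * x, y) + norm (e1, e2)"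
    using norm_triangle_ineq norm_rotation by metis
  also have "norm (e1, e2) \<le> cmod e1 + cmod e2"
    by (simp add: norm_Pair sqrt_sum_squares_le_sum)
  also have "\<dots> \<le> (dt * cmod a + 2 * dt / c * cmod b) + (dt * cmod a + dt / c * cmod b)"
  proof -
    have cos: "\<bar>cos t - 1\<bar> / s \<le> dt"
      using abs_cos_minus_one_le[of t] s0 dt by (simp add: t_def divide_le_eq mult.commute)
    have sin: "\<bar>sin t\<bar> / s \<le> dt"
      using abs_sin_x_le_abs_x[of t] s0 dt by (simp add: t_def divide_le_eq abs_mult mult.commute)
    have le_c: "r / s \<le> r' / c" if "r \<le> r'" "0 \<le> r'" for r r' :: real
      using that s c s0 by (intro frac_le) auto
    have "\<bar>s * div_diff (f11 dt) l\<bar> = \<bar>cos t - 1\<bar> / s"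
      using s0 by (simp add: div_diff_def f11_def sl t_def l_def abs_mult power2_eq_square)
    hence 1: "\<bar>s * div_diff (f11 dt) l\<bar> \<le> dt" using cos by simp
    \<comment> \<open>The subtracted \<open>dt\<close> is the value of \<open>f12\<close> at the
      node \<open>0\<close>. It is as large as the bound on \<open>sin t / s\<close>, which gives
      the factor \<open>2\<close>; the remaining \<open>1 / s\<close> is bounded by
      \<open>1 / c\<close>.\<close>
    have "\<bar>s * div_diff (f12 dt) l\<bar> = \<bar>sin t / s - dt\<bar> / s"
      using s0 sl by (simp add: div_diff_def f12_def t_def l_def abs_mult power2_eq_square)
    also have "\<dots> \<le> 2 * dt / c"
    proof (rule le_c)
      have "\<bar>sin t / s\<bar> \<le> dt" using sin s0 by simp
      thus "\<bar>sin t / s - dt\<bar> \<le> 2 * dt" using dt by linarith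
    qed (use dt in simp)
    finally have 2: "\<bar>s * div_diff (f12 dt) l\<bar> \<le> 2 * dt / c" .
    \<comment> \<open>\<open>f21\<close> vanishes at \<open>0\<close>, so this divided difference is
      just \<open>- f12 dt l\<close>.\<close>
    have "\<bar>div_diff (f21 dt) l\<bar> = \<bar>sin t\<bar> / s"
      using s0 sl by (simp add: div_diff_def f21_def f12_def t_def abs_mult)
    hence 3: "\<bar>div_diff (f21 dt) l\<bar> \<le> dt" using sin by simp
    have "\<bar>div_diff (f11 dt) l\<bar> = \<bar>cos t - 1\<bar> / s / s"
      using s0 by (simp add: div_diff_def f11_def sl t_def l_def abs_mult power2_eq_square)
    also have "\<dots> \<le> dt / c" using cos dt by (intro le_c) auto
    finally have 4: "\<bar>div_diff (f11 dt) l\<bar> \<le> dt / c" .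
    have tri: "cmod (of_real r1 * a + of_real r2 * b) \<le> R1 * cmod a + R2 * cmod b"
      if "\<bar>r1\<bar> \<le> R1" "\<bar>r2\<bar> \<le> R2" for r1 r2 R1 R2
      by (rule order_trans[OF norm_triangle_ineq])
        (use that in \<open>auto simp: norm_mult intro!: add_mono mult_right_mono\<close>)
    show ?thesis unfolding e1_def e2_def using tri[OF 1 2] tri[OF 3 4] by (rule add_mono)
  qed
  finally show ?thesis by (simp add: algebra_simps add_divide_distrib)
qed

section \<open>Energy growth over one time step\<close>

lemma kss_mat_mult_append:
  assumes N: "N > 0" and u: "u \<in> carrier_vec N" and v: "v \<in> carrier_vec N"
  shows "kss_mat p q N dt *\<^sub>v (u @\<^sub>v v) =
    (kss_block p q N (f11 dt) *\<^sub>v u + kss_block p q N (f12 dt) *\<^sub>v v) @\<^sub>v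
    (kss_block p q N (f21 dt) *\<^sub>v u + kss_block p q N (f11 dt) *\<^sub>v v)"
  unfolding kss_mat_def
  by (rule four_block_mat_mult_vec[OF kss_block(1)[OF N] kss_block(1)[OF N] kss_block(1)[OF N]
        kss_block(1)[OF N] u v])

text \<open>The mode bounds are summed by the triangle inequality for \<open>L2_set\<close>, and
  Parseval bounds the fluctuation terms by \<open>B\<close>. Since every \<open>s k\<close> is at
  least \<open>c = sqrt (average q)\<close>, the constant does not depend on
  \<open>N\<close>.\<close>

lemma energy_norm_kss_mat_le:
  assumes N: "N > 0" and p: "p \<ge> 0" and q: "average q > 0" and dt: "dt > 0"
    and B: "\<And>x. \<bar>q x - average q\<bar> \<le> B" and z: "z \<in> carrier_vec (2 * N)"
  shows "energy_norm p q N (kss_mat p q N dt *\<^sub>v z)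
    \<le> (1 + 5 / sqrt (average q) * B * dt) * energy_norm p q N z"
proof -
  define c where "c = sqrt (average q)"
  define u v where "u = vec_first z N" and "v = vec_last z N"
  have u: "u \<in> carrier_vec N" and v: "v \<in> carrier_vec N" by (auto simp: u_def v_def)
  have zuv: "z = u @\<^sub>v v"
    unfolding u_def v_def using z by (simp add: mult_2)
  let ?F = "dft_mat N" and ?l = "node p q N"
  let ?q = "mat_diag N (\<lambda>j. of_real (q (grid_point N j) - average q)) :: complex mat"
  define u' v' where "u' = (\<lambda>k. (?F *\<^sub>v u) $ k)" and "v' = (\<lambda>k. (?F *\<^sub>v v) $ k)"
  define a b where "a = (\<lambda>k. (?F *\<^sub>v (?q *\<^sub>v u)) $ k)" and "b = (\<lambda>k. (?F *\<^sub>v (?q *\<^sub>v v)) $ k)"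
  define s where "s = (\<lambda>k. sqrt (?l k))"
  define E where "E = L2_set (\<lambda>k. norm (of_real (s k) * u' k, v' k)) {..<N}"
  have c: "c > 0" using q by (simp add: c_def)
  have B0: "B \<ge> 0" using B[of 0] by simp
  have l: "?l k \<ge> average q" for k using p by (simp add: node_def)
  have l0: "?l k \<ge> 0" for k using l[of k] q by simp
  have sc: "s k \<ge> c" for k unfolding s_def c_def using l by (rule real_sqrt_le_mono)
  have s2: "(s k)\<^sup>2 = ?l k" for k using l0 by (simp add: s_def)
  have block: "kss_block p q N f *\<^sub>v w \<in> carrier_vec N" if "w \<in> carrier_vec N" for f w
    by (rule mult_mat_vec_carrier[OF kss_block(1)[OF N] that])
  have add: "(?F *\<^sub>v (x + y)) $ k = (?F *\<^sub>v x) $ k + (?F *\<^sub>v y) $ k"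
    if "x \<in> carrier_vec N" "y \<in> carrier_vec N" "k < N" for x y k
    using that by (simp add: mult_add_distrib_mat_vec[OF dft_mat_carrier] del: index_mult_mat_vec)
  have "energy_norm p q N (kss_mat p q N dt *\<^sub>v z) = sqrt (real N) *
    L2_set (\<lambda>k. norm (of_real (s k) *
        (of_real (f11 dt (?l k)) * u' k + of_real (div_diff (f11 dt) (?l k)) * a k
          + (of_real (f12 dt (?l k)) * v' k + of_real (div_diff (f12 dt) (?l k)) * b k)),
      of_real (f21 dt (?l k)) * u' k + of_real (div_diff (f21 dt) (?l k)) * a k
        + (of_real (f11 dt (?l k)) * v' k + of_real (div_diff (f11 dt) (?l k)) * b k))) {..<N}"
    unfolding zuv kss_mat_mult_append[OF N u v]
    by (subst energy_norm_dft[OF _ _ l0])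
      (auto simp: add block u v kss_block(2)[OF N] s_def u'_def v'_def a_def b_def
        simp del: index_mult_mat_vec intro!: L2_set_cong)
  also have "\<dots> \<le> sqrt (real N) * L2_set (\<lambda>k. norm (of_real (s k) * u' k, v' k)
      + dt * (2 * cmod (a k) + 3 / c * cmod (b k))) {..<N}"
    using kss_mode_bound[OF sc c dt] unfolding s2
    by (intro mult_left_mono L2_set_mono) auto
  also have "\<dots> \<le> sqrt (real N) * (E + 5 / c * B * dt * E)"
  proof (rule mult_left_mono)
    have "L2_set (\<lambda>k. dt * (2 * cmod (a k) + 3 / c * cmod (b k))) {..<N} =
      dt * L2_set (\<lambda>k. 2 * cmod (a k) + 3 / c * cmod (b k)) {..<N}"
      using dt by (simp add: L2_set_right_distrib)
    also have "L2_set (\<lambda>k. 2 * cmod (a k) + 3 / c * cmod (b k)) {..<N} \<le>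
      L2_set (\<lambda>k. 2 * cmod (a k)) {..<N} + L2_set (\<lambda>k. 3 / c * cmod (b k)) {..<N}"
      by (rule L2_set_triangle_ineq)
    also have "\<dots> = 2 * L2_set (\<lambda>k. cmod (a k)) {..<N} + 3 / c * L2_set (\<lambda>k. cmod (b k)) {..<N}"
      using c by (simp add: L2_set_right_distrib del: times_divide_eq_left)
    \<comment> \<open>The energy \<open>E\<close> controls \<open>u'\<close> only with the weight
      \<open>s k \<ge> c\<close>, which costs a factor \<open>1 / c\<close>.\<close>
    also have "L2_set (\<lambda>k. cmod (a k)) {..<N} \<le> B * (E / c)"
    proof -
      have "c * L2_set (\<lambda>k. cmod (u' k)) {..<N} = L2_set (\<lambda>k. c * cmod (u' k)) {..<N}"
        using c by (simp add: L2_set_right_distrib)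
      also have "\<dots> \<le> E"
        unfolding E_def
      proof (intro L2_set_mono)
        fix k
        have "c * cmod (u' k) \<le> norm (of_real (s k) * u' k)"
          using sc[of k] c by (auto simp: norm_mult intro!: mult_right_mono)
        also have "\<dots> \<le> norm (of_real (s k) * u' k, v' k)" by (rule norm_fst_le)
        finally show "c * cmod (u' k) \<le> norm (of_real (s k) * u' k, v' k)" .
      qed (use c in auto)
      finally have "L2_set (\<lambda>k. cmod (u' k)) {..<N} \<le> E / c"
        using c by (simp add: le_divide_eq mult.commute)
      hence "B * L2_set (\<lambda>k. cmod (u' k)) {..<N} \<le> B * (E / c)"
        using B0 by (rule mult_left_mono)
      thus ?thesis
        unfolding a_def u'_def by (rule order_trans[OF dft_potential_bound[OF u B]])
    qed
    \<comment> \<open>\<open>v'\<close> enters \<open>E\<close> unweighted. The two contributions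
      \<open>2 / c\<close> and \<open>3 / c\<close> add up to \<open>5 / c\<close>.\<close>
    also have "L2_set (\<lambda>k. cmod (b k)) {..<N} \<le> B * E"
    proof -
      have "L2_set (\<lambda>k. cmod (v' k)) {..<N} \<le> E"
        unfolding E_def by (intro L2_set_mono norm_snd_le) auto
      hence "B * L2_set (\<lambda>k. cmod (v' k)) {..<N} \<le> B * E"
        using B0 by (rule mult_left_mono)
      thus ?thesis
        unfolding b_def v'_def by (rule order_trans[OF dft_potential_bound[OF v B]])
    qed
    finally have "L2_set (\<lambda>k. dt * (2 * cmod (a k) + 3 / c * cmod (b k))) {..<N}
      \<le> 5 / c * B * dt * E"
      using dt c by (simp add: field_simps)
    thus "L2_set (\<lambda>k. norm (of_real (s k) * u' k, v' k)
        + dt * (2 * cmod (a k) + 3 / c * cmod (b k))) {..<N} \<le> E + 5 / c * B * dt * E"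
      unfolding E_def by (intro order_trans[OF L2_set_triangle_ineq] add_mono) auto
  qed simp
  also have "\<dots> = (1 + 5 / c * B * dt) * energy_norm p q N z"
    unfolding zuv energy_norm_dft[OF u v l0]
    by (simp add: E_def s_def u'_def v'_def algebra_simps del: index_mult_mat_vec)
  finally show ?thesis unfolding c_def .
qed

theorem corollary3p4:
  fixes p :: real and q :: "real \<Rightarrow> real"
  assumes "p > 0"
    and "\<And>x. q (x + 2 * pi) = q x"
    and "\<And>x. q x \<ge> 0"
    and "average q > 0"
    and "\<exists>\<omega>max :: nat. \<forall>\<omega> :: int. \<bar>\<omega>\<bar> > int \<omega>max \<longrightarrow> fourier_coeff q \<omega> = 0"
  shows "\<exists>Cq :: real. \<forall>N :: nat. \<forall>dt :: real. even N \<and> N > 0 \<and> dt > 0 \<longrightarrow>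
    energy_op_norm p q N (kss_mat p q N dt)
      \<le> 1 + ereal Cq * sup_norm (\<lambda>x. q x - average q) * ereal dt"
proof (intro exI allI impI)
  fix N :: nat and dt :: real
  assume "even N \<and> N > 0 \<and> dt > 0"
  hence N: "N > 0" and dt: "dt > 0" by auto
  \<comment> \<open>The witness for \<open>Cq\<close>; it contains neither \<open>N\<close> nor
    \<open>dt\<close>, as the order of the quantifiers demands.\<close>
  let ?C = "5 / sqrt (average q)"
  have le: "ereal \<bar>q x - average q\<bar> \<le> sup_norm (\<lambda>x. q x - average q)" for x
    unfolding sup_norm_def by (rule SUP_upper) simp
  show "energy_op_norm p q N (kss_mat p q N dt)
    \<le> 1 + ereal ?C * sup_norm (\<lambda>x. q x - average q) * ereal dt"
  proof (cases "sup_norm (\<lambda>x. q x - average q)")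
    case (real B)
    have B: "\<bar>q x - average q\<bar> \<le> B" for x using le[of x] real by simp
    hence "B \<ge> 0" using abs_ge_zero order_trans by blast
    \<comment> \<open>Covers vectors of zero energy norm, for which the quotient is \<open>0\<close>
      by the convention on division.\<close>
    hence C: "1 + ?C * B * dt \<ge> 0" using assms(4) dt by simp
    have "energy_norm p q N (kss_mat p q N dt *\<^sub>v z) / energy_norm p q N z \<le> 1 + ?C * B * dt"
      if "z \<in> carrier_vec (2 * N)" for z
    proof -
      have "energy_norm p q N z \<ge> 0"
        using assms(1,4) by (intro energy_norm_nonneg[OF that]) (simp add: node_def)
      thus ?thesis
        using energy_norm_kss_mat_le[OF N _ assms(4) dt B that, of p] assms(1) C
        by (cases "energy_norm p q N z = 0") (simp_all add: divide_le_eq)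
    qed
    thus ?thesis unfolding energy_op_norm_def real
      by (intro SUP_least) (auto simp: one_ereal_def)
  next
    \<comment> \<open>For unbounded fluctuation the right-hand side is infinite, because
      \<open>?C\<close> and \<open>dt\<close> are positive.\<close>
    case PInf
    thus ?thesis using assms(4) dt by simp
  next
    case MInf
    thus ?thesis using le[of 0] by simp
  qed
qed

end
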